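(* For $n\geq 2$ and $0\le q\le n-1$, the reduced simplicial homology satisfies $\widetilde H_q(X(n),\mathbb Z)\cong\mathbb Z^{\beta(n,q)}$, where $\beta(n,q)$ is the number of partitions of $[n]$ into $q+1$ blocks such that every block is a proper subset of $[n]$ of size at least $2$. In particular $\widetilde H_q(X(n),\mathbb Z)=0$ if $q=0$ or $q>\lfloor n/2\rfloor-1$, and for $q>0$, $$\beta(n,q)=\sum_{i=0}^{q+1}(-1)^i\binom{n}{i}\left\{{n-i\atop q-i+1}\right\},$$ where $\left\{{m\atop k}\right\}$ denotes the Stirling number of the second kind (number of partitions of an $m$-set into $k$ non-empty blocks).
   Context: For $n\ge 2$, $X(n)$ is the simplicial complex whose vertices are the proper non-empty subsets $\varnothing\neq x\subsetneq[n]$, $[n]=\{1,\dots,n\}$, and whose $q$-faces are the sets $\{x_0,\dots,x_q\}$ of $q+1$ pairwise disjoint proper non-empty subsets of $[n]$. (It is the matching complex of the complete hypergraph on $[n]$ with its isolated vertex $[n]$ removed.) Reduced homology uses the augmentation $C_0\to C_{-1}=\mathbb Z$. *)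

theory Defs
  imports "HOL-Algebra.Algebra" "HOL-Combinatorics.Stirling" "HOL-Library.Disjoint_Sets"
begin

text \<open>A simplicial complex is given by its set K of (finite, nonempty) simplices,
  each simplex being its set of vertices.  Orientation: the vertices of each simplex
  are ordered by an injective key function r into nat.  Chains are indexed by
  the number of vertices d of the simplices (so a q-simplex has d = q+1 vertices);
  the augmented complex adds the empty simplex in d = 0, the chain group C_{-1} = Z.\<close>

definition simplices_deg :: "'a set set \<Rightarrow> nat \<Rightarrow> 'a set set" where
  "simplices_deg K d = {\<sigma>. (\<sigma> \<in> K \<or> \<sigma> = {}) \<and> finite \<sigma> \<and> card \<sigma> = d}"

definition vpos :: "('a \<Rightarrow> nat) \<Rightarrow> 'a set \<Rightarrow> 'a \<Rightarrow> nat" where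
  "vpos r \<sigma> v = card {w \<in> \<sigma>. r w < r v}"

definition chain_group :: "'a set set \<Rightarrow> nat \<Rightarrow> ('a set \<Rightarrow> int) monoid" where
  "chain_group K d =
     \<lparr>carrier = {f. \<forall>\<sigma>. \<sigma> \<notin> simplices_deg K d \<longrightarrow> f \<sigma> = 0},
      monoid.mult = (\<lambda>f g \<sigma>. f \<sigma> + g \<sigma>),
      one = (\<lambda>_. 0)\<rparr>"

text \<open>boundary map C_d \<rightarrow> C_{d-1} (zero for d = 0); for d = 1 this is the augmentation\<close>
definition bd :: "'a set set \<Rightarrow> ('a \<Rightarrow> nat) \<Rightarrow> nat \<Rightarrow> ('a set \<Rightarrow> int) \<Rightarrow> ('a set \<Rightarrow> int)" where
  "bd K r d f = (\<lambda>\<tau>. if 0 < d \<and> \<tau> \<in> simplices_deg K (d - 1)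
      then (\<Sum>\<sigma>\<in>{\<sigma> \<in> simplices_deg K d. \<tau> \<subseteq> \<sigma>}.
              (-1) ^ vpos r \<sigma> (THE v. \<sigma> - \<tau> = {v}) * f \<sigma>)
      else 0)"

definition cycles :: "'a set set \<Rightarrow> ('a \<Rightarrow> nat) \<Rightarrow> nat \<Rightarrow> ('a set \<Rightarrow> int) set" where
  "cycles K r d = {f \<in> carrier (chain_group K d). bd K r d f = (\<lambda>_. 0)}"

definition boundaries :: "'a set set \<Rightarrow> ('a \<Rightarrow> nat) \<Rightarrow> nat \<Rightarrow> ('a set \<Rightarrow> int) set" where
  "boundaries K r d = bd K r (Suc d) ` carrier (chain_group K (Suc d))"

definition reduced_homology :: "'a set set \<Rightarrow> ('a \<Rightarrow> nat) \<Rightarrow> nat \<Rightarrow> ('a set \<Rightarrow> int) set monoid" where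
  "reduced_homology K r q =
     ((chain_group K (Suc q))\<lparr>carrier := cycles K r (Suc q)\<rparr>) Mod boundaries K r (Suc q)"

definition Xn :: "nat \<Rightarrow> nat set set set" where
  "Xn n = {\<sigma>. \<sigma> \<noteq> {} \<and> finite \<sigma> \<and> (\<forall>x\<in>\<sigma>. x \<noteq> {} \<and> x \<subset> {1..n}) \<and>
               (\<forall>x\<in>\<sigma>. \<forall>y\<in>\<sigma>. x \<noteq> y \<longrightarrow> x \<inter> y = {})}"

text \<open>an injective encoding of finite sets of naturals, used to order vertices\<close>
definition set_key :: "nat set \<Rightarrow> nat" where
  "set_key x = (\<Sum>i\<in>x. 2 ^ i)"

definition beta :: "nat \<Rightarrow> nat \<Rightarrow> nat" where
  "beta n q = card {P. partition_on {1..n} P \<and> card P = Suc q \<and>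
                       (\<forall>B\<in>P. 2 \<le> card B \<and> B \<noteq> {1..n})}"

end

theory Submission
  imports Defs "HOL-Library.Nat_Bijection"
begin

text \<open>
  Given a simplex \<open>\<sigma>\<close>, let \<open>U\<close> be the set of points of \<open>[n]\<close> that lie in no block of \<open>\<sigma>\<close> of size at
  least 2.  Adding or removing the vertex \<open>{min U}\<close> does not change \<open>U\<close>, so this is an acyclic matching
  on the augmented face poset whose critical simplices (\<open>U = {}\<close>) are exactly the partitions of \<open>[n]\<close>
  into proper blocks of size at least 2.  These are maximal simplices.  On the other simplices the matching
  is a contracting homotopy up to terms with more big blocks, so every cycle vanishing on the critical
  simplices bounds a chain that vanishes on them too.  Hence restricting a cycle to the critical
  simplices has the boundaries as its kernel, and it is onto.
\<close>

section \<open>The boundary as a sum over added vertices\<close>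

definition face_map :: "('a \<Rightarrow> nat) \<Rightarrow> 'a set \<Rightarrow> ('a set \<Rightarrow> int) \<Rightarrow> 'a set \<Rightarrow> int" where
  "face_map r V f \<tau> = (\<Sum>v\<in>V - \<tau>. (-1) ^ vpos r \<tau> v * f (insert v \<tau>))"

lemma vpos_insert_self [simp]: "vpos r (insert v \<tau>) v = vpos r \<tau> v"
  unfolding vpos_def by (rule arg_cong[where f = card]) auto

lemma vpos_insert:
  assumes "finite \<tau>" "w \<notin> \<tau>"
  shows "vpos r (insert w \<tau>) v = vpos r \<tau> v + (if r w < r v then 1 else 0)"
proof (cases "r w < r v")
  case True
  then have "{u \<in> insert w \<tau>. r u < r v} = insert w {u \<in> \<tau>. r u < r v}" by auto
  with assms True show ?thesis by (simp add: vpos_def)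
next
  case False
  then have "{u \<in> insert w \<tau>. r u < r v} = {u \<in> \<tau>. r u < r v}" by auto
  with False show ?thesis by (simp add: vpos_def)
qed

text \<open>Of two new vertices, the one with the smaller key shifts the position of the other by
  one and not conversely, so exactly one of the two insertion signs flips.\<close>

lemma vpos_sign_swap:
  assumes "finite \<tau>" "v \<notin> \<tau>" "w \<notin> \<tau>" "r v \<noteq> r w"
  shows "(-1::int) ^ vpos r \<tau> v * (-1) ^ vpos r (insert v \<tau>) w =
         - ((-1) ^ vpos r \<tau> w * (-1) ^ vpos r (insert w \<tau>) v)"
  using assms by (cases "r v < r w") (auto simp: vpos_insert)

text \<open>The terms for adding \<open>v\<close> then \<open>w\<close> and for adding
  \<open>w\<close> then \<open>v\<close> cancel by \<open>vpos_sign_swap\<close>.\<close>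

lemma face_map_face_map:
  assumes "finite V" "inj_on r V" "finite \<tau>"
  shows "face_map r V (face_map r V f) \<tau> = 0"
proof -
  \<comment> \<open>Setting the diagonal to 0 lets both indices range over the same set
    \<open>V - \<tau>\<close>, so that antisymmetry can be used after exchanging the sums.\<close>
  define g where "g v w = (if v = w then 0 else
    (-1) ^ vpos r \<tau> v * (-1) ^ vpos r (insert v \<tau>) w * f (insert w (insert v \<tau>)))" for v w
  have anti: "g v w = - g w v" if "v \<in> V - \<tau>" "w \<in> V - \<tau>" for v w
  proof (cases "v = w")
    case False
    then have "r v \<noteq> r w" using that assms(2) by (auto dest: inj_onD)
    with False that show ?thesis
      using vpos_sign_swap[of \<tau> v w r] assms(3) by (simp add: g_def insert_commute)
  qed (simp add: g_def)
  have "face_map r V (face_map r V f) \<tau> = (\<Sum>v\<in>V - \<tau>. \<Sum>w\<in>V - \<tau>. g v w)"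
    unfolding face_map_def sum_distrib_left
  proof (rule sum.cong[OF refl])
    fix v assume v: "v \<in> V - \<tau>"
    show "(\<Sum>w\<in>V - insert v \<tau>. (-1) ^ vpos r \<tau> v *
            ((-1) ^ vpos r (insert v \<tau>) w * f (insert w (insert v \<tau>)))) = (\<Sum>w\<in>V - \<tau>. g v w)"
      using assms(1) by (intro sum.mono_neutral_cong_left) (auto simp: g_def)
  qed
  moreover have "(\<Sum>v\<in>V - \<tau>. \<Sum>w\<in>V - \<tau>. g v w) = (\<Sum>v\<in>V - \<tau>. \<Sum>w\<in>V - \<tau>. - g w v)"
    by (intro sum.cong refl anti)
  moreover have "\<dots> = - (\<Sum>v\<in>V - \<tau>. \<Sum>w\<in>V - \<tau>. g v w)"
    by (subst sum.swap) (simp add: sum_negf)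
  ultimately show ?thesis by linarith
qed

text \<open>The simplices one vertex larger than \<tau> are the sets \<open>insert v \<tau>\<close>,
  and inserting \<open>v\<close> does not change its own position. Other sets
  \<open>insert v \<tau>\<close> contribute nothing because \<open>f\<close> vanishes off the
  simplices, so the degree and the complex drop out of the formula.\<close>

lemma bd_eq_face_map:
  assumes V: "finite V" "\<And>\<sigma>. \<sigma> \<in> K \<Longrightarrow> \<sigma> \<subseteq> V"
    and closed: "\<And>\<sigma> \<tau>. \<sigma> \<in> K \<Longrightarrow> \<tau> \<subseteq> \<sigma> \<Longrightarrow> \<tau> \<noteq> {} \<Longrightarrow> \<tau> \<in> K"
    and f: "f \<in> carrier (chain_group K d)"
  shows "bd K r d f = face_map r V f"
proof
  fix \<tau>
  have f0: "f \<sigma> = 0" if "\<sigma> \<notin> simplices_deg K d" for \<sigma>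
    using f that by (simp add: chain_group_def)
  show "bd K r d f \<tau> = face_map r V f \<tau>"
  proof (cases "0 < d \<and> \<tau> \<in> simplices_deg K (d - 1)")
    case True
    then have fin: "finite \<tau>" and card: "Suc (card \<tau>) = d" by (auto simp: simplices_deg_def)
    have "(\<Sum>\<sigma>\<in>{\<sigma> \<in> simplices_deg K d. \<tau> \<subseteq> \<sigma>}. (-1) ^ vpos r \<sigma> (THE v. \<sigma> - \<tau> = {v}) * f \<sigma>)
       = (\<Sum>v\<in>{v \<in> V - \<tau>. insert v \<tau> \<in> simplices_deg K d}. (-1) ^ vpos r \<tau> v * f (insert v \<tau>))"
    proof (rule sum.reindex_bij_betw[symmetric, THEN trans])
      let ?A = "{v \<in> V - \<tau>. insert v \<tau> \<in> simplices_deg K d}"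
      show "bij_betw (\<lambda>v. insert v \<tau>) ?A {\<sigma> \<in> simplices_deg K d. \<tau> \<subseteq> \<sigma>}"
      proof (rule bij_betw_imageI)
        show "inj_on (\<lambda>v. insert v \<tau>) ?A" by (auto simp: inj_on_def)
        have "\<sigma> \<in> (\<lambda>v. insert v \<tau>) ` ?A" if s: "\<sigma> \<in> simplices_deg K d" "\<tau> \<subseteq> \<sigma>" for \<sigma>
        proof -
          have "card (\<sigma> - \<tau>) = 1"
            using s card fin by (simp add: card_Diff_subset simplices_deg_def)
          then obtain v where v: "\<sigma> - \<tau> = {v}" by (auto simp: card_1_singleton_iff)
          then have "\<sigma> = insert v \<tau>" "v \<notin> \<tau>" using s(2) by auto
          moreover have "v \<in> V" using s(1) v V(2)[of \<sigma>] by (auto simp: simplices_deg_def)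
          ultimately show ?thesis using s by auto
        qed
        then show "(\<lambda>v. insert v \<tau>) ` ?A = {\<sigma> \<in> simplices_deg K d. \<tau> \<subseteq> \<sigma>}" by auto
      qed
      show "(\<Sum>v\<in>?A. (-1) ^ vpos r (insert v \<tau>) (THE u. insert v \<tau> - \<tau> = {u}) * f (insert v \<tau>)) =
            (\<Sum>v\<in>?A. (-1) ^ vpos r \<tau> v * f (insert v \<tau>))"
      proof (rule sum.cong[OF refl])
        fix v assume "v \<in> ?A"
        then have "insert v \<tau> - \<tau> = {v}" by auto
        then have "(THE u. insert v \<tau> - \<tau> = {u}) = v" by (auto intro!: the_equality)
        then show "(-1) ^ vpos r (insert v \<tau>) (THE u. insert v \<tau> - \<tau> = {u}) * f (insert v \<tau>) =
            (-1) ^ vpos r \<tau> v * f (insert v \<tau>)" by simp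
      qed
    qed
    also have "\<dots> = face_map r V f \<tau>"
      unfolding face_map_def using V(1) by (intro sum.mono_neutral_left) (auto simp: f0)
    finally show ?thesis using True by (simp add: bd_def)
  next
    case False
    \<comment> \<open>A nonzero term would make \<tau> a face with \<open>d - 1\<close> vertices of
      a simplex, which this case excludes.\<close>
    have "f (insert v \<tau>) = 0" if "v \<in> V - \<tau>" for v
    proof (rule f0, rule notI)
      assume "insert v \<tau> \<in> simplices_deg K d"
      then have "0 < d" "\<tau> \<in> simplices_deg K (d - 1)"
        using that closed[of "insert v \<tau>" \<tau>] by (auto simp: simplices_deg_def)
      with False show False by blast
    qed
    then show ?thesis using False by (auto simp: bd_def face_map_def)
  qed
qed

lemma face_map_in_chain_group:
  assumes closed: "\<And>\<sigma> \<tau>. \<sigma> \<in> K \<Longrightarrow> \<tau> \<subseteq> \<sigma> \<Longrightarrow> \<tau> \<noteq> {} \<Longrightarrow> \<tau> \<in> K"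
    and f: "f \<in> carrier (chain_group K (Suc d))"
  shows "face_map r V f \<in> carrier (chain_group K d)"
proof -
  have "face_map r V f \<tau> = 0" if "\<tau> \<notin> simplices_deg K d" for \<tau>
  proof -
    have "f (insert v \<tau>) = 0" if "v \<in> V - \<tau>" for v
    proof -
      have "insert v \<tau> \<notin> simplices_deg K (Suc d)"
        using that \<open>\<tau> \<notin> _\<close> closed[of "insert v \<tau>" \<tau>] by (auto simp: simplices_deg_def)
      then show ?thesis using f by (simp add: chain_group_def)
    qed
    then show ?thesis by (simp add: face_map_def)
  qed
  then show ?thesis by (simp add: chain_group_def)
qed

lemma face_map_add: "face_map r V (\<lambda>\<sigma>. f \<sigma> + g \<sigma>) \<tau> = face_map r V f \<tau> + face_map r V g \<tau>"
  by (simp add: face_map_def distrib_left sum.distrib)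

lemma face_map_diff: "face_map r V (\<lambda>\<sigma>. f \<sigma> - g \<sigma>) \<tau> = face_map r V f \<tau> - face_map r V g \<tau>"
  by (simp add: face_map_def right_diff_distrib sum_subtractf)

section \<open>The matching\<close>

definition proper_subsets :: "nat \<Rightarrow> nat set set" where
  "proper_subsets n = {x. x \<noteq> {} \<and> x \<subset> {1..n}}"

definition big :: "nat set set \<Rightarrow> nat set set" where
  "big \<sigma> = {x \<in> \<sigma>. 2 \<le> card x}"

definition uncovered :: "nat \<Rightarrow> nat set set \<Rightarrow> nat set" where
  "uncovered n \<sigma> = {1..n} - \<Union> (big \<sigma>)"

text \<open>Meaningful only for a nonempty uncovered set, since \<open>Min\<close> of the empty set
  is unspecified; hence the guard in \<open>toggle\<close>.\<close>

definition apex :: "nat \<Rightarrow> nat set set \<Rightarrow> nat set" where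
  "apex n \<sigma> = {Min (uncovered n \<sigma>)}"

text \<open>On chains this sends a simplex without its apex to that simplex with the apex added, and
  kills simplices that contain it or have none. The sign is the incidence number in the boundary
  map. As chains are functions, the value at \<sigma> is read off at \<sigma> without its
  apex.\<close>

definition toggle :: "nat \<Rightarrow> (nat set set \<Rightarrow> int) \<Rightarrow> nat set set \<Rightarrow> int" where
  "toggle n f \<sigma> = (if uncovered n \<sigma> \<noteq> {} \<and> apex n \<sigma> \<in> \<sigma>
     then (-1) ^ vpos set_key \<sigma> (apex n \<sigma>) * f (\<sigma> - {apex n \<sigma>}) else 0)"

abbreviation bdX :: "nat \<Rightarrow> (nat set set \<Rightarrow> int) \<Rightarrow> nat set set \<Rightarrow> int" where
  "bdX n \<equiv> face_map set_key (proper_subsets n)"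

lemma finite_proper_subsets [simp]: "finite (proper_subsets n)"
  by (rule finite_subset[of _ "Pow {1..n}"]) (auto simp: proper_subsets_def)

text \<open>The key is the binary encoding of finite sets, \<open>set_encode\<close>.\<close>

lemma inj_on_set_key: "inj_on set_key (proper_subsets n)"
proof -
  have "set_key = set_encode" by (simp add: fun_eq_iff set_key_def set_encode_def)
  moreover have "proper_subsets n \<subseteq> Collect finite"
    by (auto simp: proper_subsets_def intro: finite_subset)
  ultimately show ?thesis using inj_on_set_encode inj_on_subset by metis
qed

lemma Xn_subset: "\<sigma> \<in> Xn n \<Longrightarrow> \<sigma> \<subseteq> proper_subsets n"
  by (auto simp: Xn_def proper_subsets_def)

lemma Xn_closed:
  assumes "\<sigma> \<in> Xn n" "\<tau> \<subseteq> \<sigma>" "\<tau> \<noteq> {}"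
  shows "\<tau> \<in> Xn n"
proof -
  have "finite \<tau>" using assms by (auto simp: Xn_def intro: finite_subset)
  with assms show ?thesis unfolding Xn_def mem_Collect_eq by blast
qed

text \<open>The empty simplex of the augmentation needs no separate case on the right, and
  finiteness is automatic since there are finitely many vertices.\<close>

lemma simplices_deg_Xn:
  "\<sigma> \<in> simplices_deg (Xn n) d \<longleftrightarrow> \<sigma> \<subseteq> proper_subsets n \<and> disjoint \<sigma> \<and> card \<sigma> = d"
proof -
  have "finite \<sigma>" if "\<sigma> \<subseteq> proper_subsets n" using that finite_proper_subsets finite_subset by blast
  then show ?thesis by (auto simp: simplices_deg_def Xn_def proper_subsets_def disjoint_def)
qed

lemma bd_Xn:
  "f \<in> carrier (chain_group (Xn n) d) \<Longrightarrow> bd (Xn n) set_key d f = bdX n f"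
  by (rule bd_eq_face_map) (simp_all add: Xn_subset Xn_closed)

lemma finite_uncovered [simp]: "finite (uncovered n \<sigma>)"
  by (simp add: uncovered_def)

lemma singleton_if_not_big:
  assumes "v \<in> proper_subsets n" "\<not> 2 \<le> card v"
  obtains i where "v = {i}"
proof -
  have "finite v" using assms(1) by (auto simp: proper_subsets_def intro: finite_subset)
  then have "card v = 1" using assms card_0_eq[of v] by (auto simp: proper_subsets_def simp del: card_0_eq)
  then show ?thesis using that by (auto simp: card_1_singleton_iff)
qed

text \<open>Singletons are never big. This is why adding or removing the apex changes neither the
  uncovered set nor the apex.\<close>

lemma big_insert_singleton [simp]: "big (insert {i} \<sigma>) = big \<sigma>"
  and big_diff_singleton [simp]: "big (\<sigma> - {{i}}) = big \<sigma>"
  by (auto simp: big_def)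

lemma uncovered_insert_singleton [simp]: "uncovered n (insert {i} \<sigma>) = uncovered n \<sigma>"
  by (simp add: uncovered_def)

lemma apex_insert_singleton [simp]: "apex n (insert {i} \<sigma>) = apex n \<sigma>"
  by (simp add: apex_def)

text \<open>This is where \<open>2 \<le> n\<close> enters: it makes singletons proper
  subsets.\<close>

lemma apex_proper:
  assumes "2 \<le> n" "uncovered n \<sigma> \<noteq> {}"
  shows "apex n \<sigma> \<in> proper_subsets n"
proof -
  have "Min (uncovered n \<sigma>) \<in> {1..n}"
    using Min_in[OF finite_uncovered assms(2)] by (simp add: uncovered_def)
  then have "apex n \<sigma> \<subseteq> {1..n}" "apex n \<sigma> \<noteq> {}" by (simp_all add: apex_def)
  moreover have "card (apex n \<sigma>) \<noteq> card {1..n}" using assms(1) by (simp add: apex_def)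
  then have "apex n \<sigma> \<noteq> {1..n}" by metis
  ultimately show ?thesis unfolding proper_subsets_def by blast
qed

text \<open>The apex meets no other vertex: big ones avoid it by the choice of its point, and
  another singleton is disjoint from it. So adding it to a simplex gives a simplex.\<close>

lemma toggle_in_chain_group:
  assumes n: "2 \<le> n" and f: "f \<in> carrier (chain_group (Xn n) d)"
  shows "toggle n f \<in> carrier (chain_group (Xn n) (Suc d))"
proof -
  have "\<rho> \<in> simplices_deg (Xn n) (Suc d)" if nz: "toggle n f \<rho> \<noteq> 0" for \<rho>
  proof -
    let ?i = "Min (uncovered n \<rho>)"
    have U: "uncovered n \<rho> \<noteq> {}" and a: "{?i} \<in> \<rho>" and "f (\<rho> - {{?i}}) \<noteq> 0"
      using nz by (auto simp: toggle_def apex_def split: if_splits)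
    then have s: "\<rho> - {{?i}} \<in> simplices_deg (Xn n) d"
      using f by (auto simp: chain_group_def)
    have i: "?i \<in> uncovered n \<rho>" using U by simp
    have "apex n \<rho> \<in> proper_subsets n" using n U by (rule apex_proper)
    then have sub: "\<rho> \<subseteq> proper_subsets n"
      using s by (auto simp: simplices_deg_Xn apex_def)
    have "?i \<notin> x" if x: "x \<in> \<rho> - {{?i}}" for x
    proof
      assume "?i \<in> x"
      with i x have "\<not> 2 \<le> card x" by (auto simp: uncovered_def big_def)
      with x sub obtain j where "x = {j}" by (meson DiffD1 singleton_if_not_big subsetD)
      with \<open>?i \<in> x\<close> x show False by auto
    qed
    then have ix: "x \<inter> {?i} = {}" "{?i} \<inter> x = {}" if "x \<in> \<rho>" "x \<noteq> {?i}" for x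
      using that by blast+
    have dis: "disjoint (\<rho> - {{?i}})" using s by (simp add: simplices_deg_Xn)
    have "disjoint \<rho>"
    proof (rule disjointI)
      fix x y assume xy: "x \<in> \<rho>" "y \<in> \<rho>" "x \<noteq> y"
      show "x \<inter> y = {}"
      proof (cases "x = {?i} \<or> y = {?i}")
        case True
        then show ?thesis using xy ix by metis
      next
        case False
        then show ?thesis using xy disjointD[OF dis] by blast
      qed
    qed
    moreover have "card \<rho> = Suc d"
    proof -
      have "finite \<rho>" using sub finite_proper_subsets finite_subset by blast
      then show ?thesis using s a by (metis card_Suc_Diff1 simplices_deg_Xn)
    qed
    ultimately show ?thesis using sub by (simp add: simplices_deg_Xn)
  qed
  then show ?thesis by (auto simp: chain_group_def)
qed

text \<open>
  For a cycle \<open>z\<close> whose support has at most \<open>m\<close> big blocks, in \<open>\<partial>(toggle z)\<close> at a simplex with at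
  least \<open>m\<close> big blocks only added singletons contribute, and these leave the apex unchanged.  If the apex
  is already in \<open>\<sigma>\<close>, the remaining terms are evaluated by the cycle condition at the face opposite to it.
\<close>

lemma bdX_toggle_eq:
  assumes z: "\<And>\<tau>. bdX n z \<tau> = 0"
    and top: "\<And>\<rho>. \<rho> \<subseteq> proper_subsets n \<Longrightarrow> m < card (big \<rho>) \<Longrightarrow> z \<rho> = 0"
    and s: "\<sigma> \<subseteq> proper_subsets n" "uncovered n \<sigma> \<noteq> {}" "m \<le> card (big \<sigma>)"
    and a: "apex n \<sigma> \<in> proper_subsets n"
  shows "bdX n (toggle n z) \<sigma> = z \<sigma>"
proof -
  define V where "V = proper_subsets n"
  define a where "a = apex n \<sigma>"
  have aV: "a \<in> V" and sV: "\<sigma> \<subseteq> V" using assms by (simp_all add: a_def V_def)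
  have finV: "finite V" by (simp add: V_def)
  then have fin: "finite \<sigma>" using sV finite_subset by blast
  obtain i where ai: "a = {i}" by (simp add: a_def apex_def)
  have not_big: "\<not> 2 \<le> card a" by (simp add: ai)
  \<comment> \<open>A new big vertex pushes the number of big blocks above \<open>m\<close>, even if
    the apex \<open>a\<close>, which is not big, is dropped.\<close>
  have big_zero: "z \<rho> = 0" if r: "\<rho> \<subseteq> V" "v \<in> \<rho>" "v \<notin> \<sigma>" "2 \<le> card v" "\<sigma> - {a} \<subseteq> \<rho>" for v \<rho>
  proof (rule top)
    have "finite \<rho>" using r(1) finV finite_subset by blast
    moreover have "insert v (big \<sigma>) \<subseteq> big \<rho>" using r not_big by (auto simp: big_def)
    ultimately have "card (insert v (big \<sigma>)) \<le> card (big \<rho>)"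
      by (intro card_mono) (auto simp: big_def)
    moreover have "card (insert v (big \<sigma>)) = Suc (card (big \<sigma>))"
      using fin r(3) by (subst card_insert_disjoint) (auto simp: big_def)
    ultimately show "m < card (big \<rho>)" using s(3) by simp
    show "\<rho> \<subseteq> proper_subsets n" using r(1) by (simp add: V_def)
  qed
  \<comment> \<open>The apex of \<open>insert v \<sigma>\<close> may be replaced by
    \<open>a\<close>. For a singleton \<open>v\<close> they agree; for a big \<open>v\<close> they
    may differ, but then both sides are 0 by the bound on big blocks.\<close>
  have tog: "toggle n z (insert v \<sigma>) =
      (if a \<in> insert v \<sigma> then (-1) ^ vpos set_key (insert v \<sigma>) a * z (insert v \<sigma> - {a}) else 0)"
    if v: "v \<in> V - \<sigma>" for v
  proof (cases "2 \<le> card v")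
    case True
    have big: "big (insert v \<sigma>) = insert v (big \<sigma>)" using True by (auto simp: big_def)
    have "toggle n z (insert v \<sigma>) = 0"
    proof -
      have "z (insert v \<sigma> - {apex n (insert v \<sigma>)}) = 0"
      proof (rule top)
        let ?\<rho> = "insert v \<sigma> - {apex n (insert v \<sigma>)}"
        show "?\<rho> \<subseteq> proper_subsets n" using v sV by (auto simp: V_def)
        have "big ?\<rho> = insert v (big \<sigma>)" by (simp add: apex_def big)
        then show "m < card (big ?\<rho>)"
          using fin v s(3) by (simp add: big_def)
      qed
      then show ?thesis by (simp add: toggle_def)
    qed
    moreover have "z (insert v \<sigma> - {a}) = 0"
      using True v sV not_big by (intro big_zero[of _ v]) auto
    ultimately show ?thesis by simp
  next
    case False
    with v obtain j where "v = {j}" by (metis DiffD1 V_def singleton_if_not_big)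
    then show ?thesis using s(2) by (simp add: toggle_def a_def)
  qed
  show ?thesis
  proof (cases "a \<in> \<sigma>")
    case False
    \<comment> \<open>Only \<open>v = a\<close> brings the apex into
      \<open>insert v \<sigma>\<close>, and its two equal signs multiply to 1.\<close>
    have "bdX n (toggle n z) \<sigma> = (\<Sum>v\<in>V - \<sigma>. if v = a then z \<sigma> else 0)"
      unfolding face_map_def V_def[symmetric]
    proof (rule sum.cong[OF refl])
      fix v assume v: "v \<in> V - \<sigma>"
      show "(-1) ^ vpos set_key \<sigma> v * toggle n z (insert v \<sigma>) = (if v = a then z \<sigma> else 0)"
        using False by (auto simp: tog[OF v] simp flip: mult.assoc power_add)
    qed
    also have "\<dots> = z \<sigma>" using False aV finV by simp
    finally show ?thesis .
  next
    case True
    define \<tau> where "\<tau> = \<sigma> - {a}"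
    have \<sigma>: "\<sigma> = insert a \<tau>" "a \<notin> \<tau>" using True by (auto simp: \<tau>_def)
    have fint: "finite \<tau>" using fin by (simp add: \<tau>_def)
    \<comment> \<open>The cycle condition at \<tau> has one term for \<sigma> itself; solving for it
      expresses \<open>z \<sigma>\<close> by the other cofaces of \<tau>.\<close>
    have "0 = bdX n z \<tau>" using z by simp
    also have "\<dots> = (\<Sum>v\<in>insert a (V - \<sigma>). (-1) ^ vpos set_key \<tau> v * z (insert v \<tau>))"
      unfolding face_map_def V_def[symmetric] using aV \<sigma> by (intro sum.cong) auto
    also have "\<dots> = (-1) ^ vpos set_key \<tau> a * z \<sigma> + (\<Sum>v\<in>V - \<sigma>. (-1) ^ vpos set_key \<tau> v * z (insert v \<tau>))"
      using finV True by (subst sum.insert) (auto simp: \<sigma>)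
    finally have eq: "(\<Sum>v\<in>V - \<sigma>. (-1) ^ vpos set_key \<tau> v * z (insert v \<tau>)) = - ((-1) ^ vpos set_key \<tau> a * z \<sigma>)"
      by simp
    have "bdX n (toggle n z) \<sigma> = (\<Sum>v\<in>V - \<sigma>. - ((-1) ^ vpos set_key \<tau> a * ((-1) ^ vpos set_key \<tau> v * z (insert v \<tau>))))"
      unfolding face_map_def V_def[symmetric]
    proof (rule sum.cong[OF refl])
      fix v assume v: "v \<in> V - \<sigma>"
      have va: "v \<noteq> a" "v \<notin> \<tau>" using v \<sigma> by auto
      have "set_key v \<noteq> set_key a"
        using v aV va inj_on_set_key[of n] by (auto simp: V_def dest: inj_onD)
      then have sw: "(-1::int) ^ vpos set_key \<tau> v * (-1) ^ vpos set_key (insert v \<tau>) a =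
          - ((-1) ^ vpos set_key \<tau> a * (-1) ^ vpos set_key \<sigma> v)"
        using vpos_sign_swap[of \<tau> v a set_key] fint va \<sigma> by simp
      have "insert v \<sigma> - {a} = insert v \<tau>" using va \<sigma> by auto
      moreover have "vpos set_key (insert v \<sigma>) a = vpos set_key (insert v \<tau>) a"
        by (simp add: \<sigma> insert_commute[of v])
      ultimately have "(-1) ^ vpos set_key \<sigma> v * toggle n z (insert v \<sigma>) =
          (-1) ^ vpos set_key \<sigma> v * (-1) ^ vpos set_key (insert v \<tau>) a * z (insert v \<tau>)"
        using True by (simp add: tog[OF v])
      \<comment> \<open>This is \<open>sw\<close> multiplied by the signs of \<open>v\<close>
        relative to \<sigma> and to \<tau>, each its own inverse.\<close>
      also have "(-1::int) ^ vpos set_key \<sigma> v * (-1) ^ vpos set_key (insert v \<tau>) a =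
          - ((-1) ^ vpos set_key \<tau> a * (-1) ^ vpos set_key \<tau> v)"
        using sw by (cases "even (vpos set_key \<tau> v)"; cases "even (vpos set_key \<tau> a)";
            cases "even (vpos set_key \<sigma> v)") auto
      finally show "(-1) ^ vpos set_key \<sigma> v * toggle n z (insert v \<sigma>) =
          - ((-1) ^ vpos set_key \<tau> a * ((-1) ^ vpos set_key \<tau> v * z (insert v \<tau>)))" by simp
    qed
    also have "\<dots> = - ((-1) ^ vpos set_key \<tau> a * (\<Sum>v\<in>V - \<sigma>. (-1) ^ vpos set_key \<tau> v * z (insert v \<tau>)))"
      by (simp only: sum_distrib_left sum_negf)
    also have "\<dots> = z \<sigma>" by (simp add: eq flip: mult.assoc power_add)
    finally show ?thesis .
  qed
qed

section \<open>Acyclicity away from the critical simplices\<close>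

lemma toggle_covered: "uncovered n \<sigma> = {} \<Longrightarrow> toggle n z \<sigma> = 0"
  by (simp add: toggle_def)

text \<open>Adding a vertex can only shrink the uncovered set, so \<open>toggle\<close> vanishes on
  all cofaces as well.\<close>

lemma bdX_toggle_covered:
  assumes "uncovered n \<sigma> = {}"
  shows "bdX n (toggle n z) \<sigma> = 0"
  unfolding face_map_def
proof (intro sum.neutral ballI)
  fix v
  have "uncovered n (insert v \<sigma>) \<subseteq> uncovered n \<sigma>" by (auto simp: uncovered_def big_def)
  then show "(-1) ^ vpos set_key \<sigma> v * toggle n z (insert v \<sigma>) = 0"
    using assms by (simp add: toggle_covered)
qed

lemma chain_outside:
  "f \<in> carrier (chain_group K d) \<Longrightarrow> \<sigma> \<notin> simplices_deg K d \<Longrightarrow> f \<sigma> = 0"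
  by (simp add: chain_group_def)

text \<open>Induction on a strict bound \<open>m\<close> for the number of big blocks in the
  support. Subtracting the boundary of \<open>toggle n z\<close> clears the top layer by
  \<open>bdX_toggle_eq\<close>, and the remainder is again a cycle that vanishes on the covered
  sets.\<close>

lemma noncritical_acyclic_aux:
  assumes n: "2 \<le> n"
    and "z \<in> carrier (chain_group (Xn n) d)" "\<And>\<tau>. bdX n z \<tau> = 0"
    and "\<And>\<sigma>. uncovered n \<sigma> = {} \<Longrightarrow> z \<sigma> = 0"
    and "\<And>\<sigma>. \<sigma> \<subseteq> proper_subsets n \<Longrightarrow> m \<le> card (big \<sigma>) \<Longrightarrow> z \<sigma> = 0"
  shows "\<exists>c \<in> carrier (chain_group (Xn n) (Suc d)).
           (\<forall>\<sigma>. uncovered n \<sigma> = {} \<longrightarrow> c \<sigma> = 0) \<and> bdX n c = z"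
  using assms(2-)
proof (induction m arbitrary: z)
  case 0
  have "z \<sigma> = 0" for \<sigma>
    using 0(4)[of \<sigma>] chain_outside[OF 0(1)] by (auto simp: simplices_deg_Xn)
  then show ?case
    by (intro bexI[of _ "\<lambda>_. 0"]) (auto simp: face_map_def chain_group_def)
next
  case (Suc m)
  let ?t = "toggle n z"
  let ?z = "\<lambda>\<sigma>. z \<sigma> - bdX n ?t \<sigma>"
  have t: "?t \<in> carrier (chain_group (Xn n) (Suc d))"
    by (rule toggle_in_chain_group[OF n Suc.prems(1)])
  have bt: "bdX n ?t \<in> carrier (chain_group (Xn n) d)"
    by (intro face_map_in_chain_group[OF _ t]) (rule Xn_closed)
  have z': "?z \<in> carrier (chain_group (Xn n) d)"
    using Suc.prems(1) bt by (simp add: chain_group_def)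
  have "\<exists>c \<in> carrier (chain_group (Xn n) (Suc d)).
           (\<forall>\<sigma>. uncovered n \<sigma> = {} \<longrightarrow> c \<sigma> = 0) \<and> bdX n c = ?z"
  proof (rule Suc.IH[OF z'])
    fix \<tau>
    show "bdX n ?z \<tau> = 0"
    \<comment> \<open>Chains are functions on all sets, including infinite ones, where everything
      involved is 0.\<close>
    proof (cases "finite \<tau>")
      case True
      then show ?thesis
        by (simp add: face_map_diff Suc.prems(2) face_map_face_map inj_on_set_key)
    next
      case False
      then have "?z (insert v \<tau>) = 0" for v
        by (intro chain_outside[OF z']) (simp add: simplices_deg_def)
      then show ?thesis unfolding face_map_def by (intro sum.neutral) simp
    qed
  next
    fix \<sigma> assume "uncovered n \<sigma> = {}"
    then show "?z \<sigma> = 0" by (simp add: Suc.prems(3) bdX_toggle_covered)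
  next
    fix \<sigma> assume s: "\<sigma> \<subseteq> proper_subsets n" "m \<le> card (big \<sigma>)"
    show "?z \<sigma> = 0"
    proof (cases "uncovered n \<sigma> = {}")
      case False
      then have "bdX n ?t \<sigma> = z \<sigma>"
        using s apex_proper[OF n] Suc.prems(2,4) by (intro bdX_toggle_eq[where m = m]) auto
      then show ?thesis by simp
    qed (simp add: Suc.prems(3) bdX_toggle_covered)
  qed
  then obtain c where c: "c \<in> carrier (chain_group (Xn n) (Suc d))"
    "\<And>\<sigma>. uncovered n \<sigma> = {} \<Longrightarrow> c \<sigma> = 0" "bdX n c = ?z" by blast
  show ?case
  proof (intro bexI conjI allI impI)
    show "(\<lambda>\<sigma>. c \<sigma> + ?t \<sigma>) \<in> carrier (chain_group (Xn n) (Suc d))"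
      using c(1) t by (simp add: chain_group_def)
    show "bdX n (\<lambda>\<sigma>. c \<sigma> + ?t \<sigma>) = z"
      by (rule ext) (simp add: face_map_add c(3))
  qed (simp add: c(2) toggle_covered)
qed

text \<open>The number of big blocks is at most the number of vertices, which supplies a bound to
  start the induction from.\<close>

lemma noncritical_acyclic:
  assumes "2 \<le> n"
    and "z \<in> carrier (chain_group (Xn n) d)" "\<And>\<tau>. bdX n z \<tau> = 0"
    and "\<And>\<sigma>. uncovered n \<sigma> = {} \<Longrightarrow> z \<sigma> = 0"
  obtains c where "c \<in> carrier (chain_group (Xn n) (Suc d))"
    "\<And>\<sigma>. uncovered n \<sigma> = {} \<Longrightarrow> c \<sigma> = 0" "bdX n c = z"
proof -
  have "z \<sigma> = 0" if "\<sigma> \<subseteq> proper_subsets n" "Suc (card (proper_subsets n)) \<le> card (big \<sigma>)" for \<sigma>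
  proof -
    have "card (big \<sigma>) \<le> card (proper_subsets n)"
      using that(1) by (intro card_mono) (auto simp: big_def)
    with that(2) show ?thesis by simp
  qed
  from noncritical_acyclic_aux[OF assms this] that show ?thesis by blast
qed

section \<open>Counting partitions without singletons\<close>

text \<open>Counted by the associated Stirling numbers of the second kind. Unlike in
  \<open>beta\<close>, the whole set may be a block.\<close>

definition nosing_partitions :: "'a set \<Rightarrow> nat \<Rightarrow> 'a set set set" where
  "nosing_partitions A k = {P. partition_on A P \<and> card P = k \<and> (\<forall>B\<in>P. 2 \<le> card B)}"

lemma nosing_partitionsD:
  assumes "P \<in> nosing_partitions A k"
  shows "partition_on A P" "card P = k" "B \<in> P \<Longrightarrow> 2 \<le> card B"
  using assms by (auto simp: nosing_partitions_def)

lemma finite_nosing_partitions [simp]: "finite A \<Longrightarrow> finite (nosing_partitions A k)"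
  by (rule finite_subset[OF _ finitely_many_partition_on]) (auto simp: nosing_partitions_def)

lemma nosing_partitions_insert_iff:
  assumes "finite A" "disjnt B (\<Union>R)" "B \<noteq> {}"
  shows "insert B R \<in> nosing_partitions A (Suc k) \<longleftrightarrow>
         R \<in> nosing_partitions (A - B) k \<and> B \<subseteq> A \<and> 2 \<le> card B"
proof -
  have B: "B \<notin> R" using assms by (auto simp: disjnt_def)
  have "finite R" if "partition_on (A - B) R" using finite_elements[OF _ that] assms(1) by simp
  then show ?thesis using assms B
    by (auto simp: nosing_partitions_def partition_on_insert)
qed

lemma nosing_partitions_remove:
  assumes "finite A" "P \<in> nosing_partitions A (Suc k)" "B \<in> P"
  shows "P - {B} \<in> nosing_partitions (A - B) k" "B \<subseteq> A" "2 \<le> card B" "disjnt B (\<Union>(P - {B}))"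
proof -
  have part: "partition_on A P" using assms(2) by (rule nosing_partitionsD)
  show d: "disjnt B (\<Union>(P - {B}))"
    using disjointD[OF partition_onD2[OF part] assms(3)] by (auto simp: disjnt_def)
  have "B \<noteq> {}" using partition_onD3[OF part] assms(3) by auto
  then show "P - {B} \<in> nosing_partitions (A - B) k" "B \<subseteq> A" "2 \<le> card B"
    using nosing_partitions_insert_iff[OF assms(1) d, of k] assms(2,3) by (simp_all add: insert_absorb)
qed

lemma nosing_partitions_disjnt:
  assumes "R \<in> nosing_partitions (A - B) k" shows "disjnt B (\<Union>R)"
  using partition_onD1[OF nosing_partitionsD(1)[OF assms]] by (auto simp: disjnt_def)

text \<open>Double counting of partitions with a marked block: either the block \<open>B\<close> is
  chosen first, or the partition and then one of its \<open>Suc k\<close> blocks.\<close>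

lemma sum_card_nosing_partitions_block:
  assumes A: "finite A"
  shows "(\<Sum>B | B \<subseteq> A \<and> 2 \<le> card B. card (nosing_partitions (A - B) k)) =
         Suc k * card (nosing_partitions A (Suc k))"
proof -
  let ?S = "SIGMA B:{B. B \<subseteq> A \<and> 2 \<le> card B}. nosing_partitions (A - B) k"
  let ?T = "SIGMA P:nosing_partitions A (Suc k). P"
  have "bij_betw (\<lambda>(B, R). (insert B R, B)) ?S ?T"
  proof (rule bij_betw_byWitness[where f' = "\<lambda>(P, B). (B, P - {B})"])
    have "B \<notin> R" if "(B, R) \<in> ?S" for B R
    proof
      assume "B \<in> R"
      with that nosing_partitions_disjnt[of R A B k] have "B = {}" by (auto simp: disjnt_def)
      with that show False by simp
    qed
    then show "\<forall>a\<in>?S. (\<lambda>(P, B). (B, P - {B})) ((\<lambda>(B, R). (insert B R, B)) a) = a" by auto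
    show "\<forall>a\<in>?T. (\<lambda>(B, R). (insert B R, B)) ((\<lambda>(P, B). (B, P - {B})) a) = a"
      by (auto simp: insert_absorb)
    have "insert B R \<in> nosing_partitions A (Suc k)" if "(B, R) \<in> ?S" for B R
    proof -
      have "B \<noteq> {}" using that by auto
      with that show ?thesis
        using nosing_partitions_insert_iff[OF A nosing_partitions_disjnt[of R A B k]] by auto
    qed
    then show "(\<lambda>(B, R). (insert B R, B)) ` ?S \<subseteq> ?T" by auto
    have "(B, P - {B}) \<in> ?S" if "P \<in> nosing_partitions A (Suc k)" "B \<in> P" for P B
      using nosing_partitions_remove(1-3)[OF A that] by simp
    then show "(\<lambda>(P, B). (B, P - {B})) ` ?T \<subseteq> ?S" by auto
  qed
  then have "card ?S = card ?T" by (rule bij_betw_same_card)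
  moreover have "card ?S = (\<Sum>B | B \<subseteq> A \<and> 2 \<le> card B. card (nosing_partitions (A - B) k))"
    using A by (subst card_SigmaI) auto
  moreover have "card ?T = (\<Sum>P\<in>nosing_partitions A (Suc k). card P)"
    using A finite_elements[OF A] by (subst card_SigmaI) (auto dest: nosing_partitionsD(1))
  moreover have "\<dots> = Suc k * card (nosing_partitions A (Suc k))"
    by (simp add: nosing_partitionsD(2))
  ultimately show ?thesis by simp
qed

text \<open>Removes the block containing \<open>x\<close>. Here \<open>B\<close> is that block
  without \<open>x\<close>, nonempty because blocks have at least two points.\<close>

lemma card_nosing_partitions_insert_sum:
  assumes A: "finite A" and x: "x \<notin> A"
  shows "card (nosing_partitions (insert x A) (Suc k)) =
         (\<Sum>B | B \<subseteq> A \<and> B \<noteq> {}. card (nosing_partitions (A - B) k))"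
proof -
  let ?S = "SIGMA B:{B. B \<subseteq> A \<and> B \<noteq> {}}. nosing_partitions (A - B) k"
  let ?f = "\<lambda>(B, R). insert (insert x B) R"
  let ?T = "nosing_partitions (insert x A) (Suc k)"
  have diff: "insert x A - insert x B = A - B" for B using x by auto
  have xR: "x \<notin> \<Union>R" "x \<notin> B" if "(B, R) \<in> ?S" for B R
    using that x partition_onD1[OF nosing_partitionsD(1)[of R "A - B" k]] by auto
  have inj: "inj_on ?f ?S"
  proof (rule inj_onI, clarsimp)
    fix B R B' R'
    assume BR: "B \<subseteq> A" "B \<noteq> {}" "R \<in> nosing_partitions (A - B) k"
      "B' \<subseteq> A" "B' \<noteq> {}" "R' \<in> nosing_partitions (A - B') k"
      and eq: "insert (insert x B) R = insert (insert x B') R'"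
    have 1: "x \<notin> \<Union>R" "x \<notin> B" "x \<notin> \<Union>R'" "x \<notin> B'" using xR[of B R] xR[of B' R'] BR by auto
    \<comment> \<open>Both sides are the unique block containing \<open>x\<close>.\<close>
    then have "insert x B = insert x B'" using eq by blast
    with 1 have "B = B'" by auto
    moreover have "insert x B \<notin> R" "insert x B' \<notin> R'" using 1 by auto
    then have "R = R'" using eq \<open>B = B'\<close> by (metis Diff_insert_absorb)
    ultimately show "B = B' \<and> R = R'" by simp
  qed
  have im: "?f ` ?S = ?T"
  proof
    have "insert (insert x B) R \<in> ?T" if "(B, R) \<in> ?S" for B R
    proof -
      have "disjnt (insert x B) (\<Union>R)" and xB: "x \<notin> B"
        using that nosing_partitions_disjnt[of R A B k] xR[OF that] by auto
      moreover have "finite B" using that A by (auto intro: finite_subset)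
      with xB that have "2 \<le> card (insert x B)" by (auto simp: Suc_le_eq card_gt_0_iff)
      ultimately show ?thesis
        using that A by (subst nosing_partitions_insert_iff) (auto simp: diff)
    qed
    then show "?f ` ?S \<subseteq> ?T" by auto
    show "?T \<subseteq> ?f ` ?S"
    proof
      fix P assume P: "P \<in> ?T"
      obtain C where C: "C \<in> P" "x \<in> C"
        using partition_onD1[OF nosing_partitionsD(1)[OF P]] by auto
      note rem = nosing_partitions_remove[OF _ P C(1)]
      have "insert x A - C = A - (C - {x})" using C x by auto
      moreover have "C - {x} \<noteq> {}"
      proof
        assume "C - {x} = {}"
        then have "C = {x}" using C by auto
        with rem(3) A show False by simp
      qed
      ultimately have "(C - {x}, P - {C}) \<in> ?S" using rem(1,2) A by auto
      moreover have "?f (C - {x}, P - {C}) = P" using C by (auto simp: insert_absorb)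
      ultimately show "P \<in> ?f ` ?S" by (metis (no_types, lifting) image_eqI)
    qed
  qed
  have "card ?T = card ?S" unfolding im[symmetric] by (rule card_image[OF inj])
  also have "\<dots> = (\<Sum>B | B \<subseteq> A \<and> B \<noteq> {}. card (nosing_partitions (A - B) k))"
    using A by (subst card_SigmaI) auto
  finally show ?thesis .
qed

text \<open>The recurrence of the associated Stirling numbers: the companions \<open>B\<close> of
  \<open>x\<close> either form a block of size at least 2 by themselves, which double counting
  evaluates, or consist of one point \<open>y\<close>.\<close>

lemma card_nosing_partitions_insert:
  assumes A: "finite A" and x: "x \<notin> A"
  shows "card (nosing_partitions (insert x A) (Suc k)) =
         Suc k * card (nosing_partitions A (Suc k)) + (\<Sum>y\<in>A. card (nosing_partitions (A - {y}) k))"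
proof -
  let ?p = "\<lambda>B. card (nosing_partitions (A - B) k)"
  have split: "{B. B \<subseteq> A \<and> B \<noteq> {}} = {B. B \<subseteq> A \<and> 2 \<le> card B} \<union> (\<lambda>y. {y}) ` A"
  proof -
    have "\<exists>y\<in>A. B = {y}" if "B \<subseteq> A" "B \<noteq> {}" "\<not> 2 \<le> card B" for B
    proof -
      have "finite B" using that A finite_subset by blast
      then have "card B = 1" using that card_gt_0_iff[of B] by linarith
      then show ?thesis using that by (auto simp: card_1_singleton_iff)
    qed
    then show ?thesis by auto
  qed
  have "sum ?p {B. B \<subseteq> A \<and> B \<noteq> {}} =
        sum ?p {B. B \<subseteq> A \<and> 2 \<le> card B} + sum ?p ((\<lambda>y. {y}) ` A)"
    unfolding split using A by (intro sum.union_disjoint) auto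
  also have "sum ?p ((\<lambda>y. {y}) ` A) = (\<Sum>y\<in>A. ?p {y})"
    by (subst sum.reindex) auto
  finally show ?thesis
    using sum_card_nosing_partitions_block[OF A, of k] card_nosing_partitions_insert_sum[OF A x, of k]
    by simp
qed

text \<open>The inclusion-exclusion expression over sets of \<open>i\<close> points forced to be
  singleton blocks. Truncation of \<open>n - i\<close> is harmless, as \<open>n choose i\<close> is
  0 for \<open>i > n\<close>.\<close>

definition nosing_altsum :: "nat \<Rightarrow> nat \<Rightarrow> int" where
  "nosing_altsum n k = (\<Sum>i\<le>k. (-1) ^ i * int (n choose i) * int (Stirling (n - i) (k - i)))"

text \<open>At \<open>n = 0\<close> the truncated \<open>n - 1\<close> is harmless because of the factor \<open>n\<close>.\<close>

lemma nosing_altsum_Suc_Suc: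
  "nosing_altsum (Suc n) (Suc k) = int (Suc k) * nosing_altsum n (Suc k) + int n * nosing_altsum (n - 1) k"
proof -
  let ?c = "\<lambda>i. (-1) ^ i * int (n choose i)"
  let ?S = "\<lambda>i j. int (Stirling i j)"
  \<comment> \<open>Pascal's rule, with the index of the second part shifted by one.\<close>
  have pascal: "nosing_altsum (Suc n) (Suc k) = (\<Sum>i\<le>Suc k. ?c i * ?S (Suc n - i) (Suc k - i))
      - (\<Sum>i\<le>k. ?c i * ?S (n - i) (k - i))"
    unfolding nosing_altsum_def
    by (simp add: sum.atMost_Suc_shift algebra_simps sum.distrib sum_subtractf sum_negf
        del: Stirling.simps sum.atMost_Suc)
  \<comment> \<open>The last term of the Stirling recurrence cancels the sum subtracted in
    \<open>pascal\<close>.\<close>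
  have stir: "?c i * ?S (Suc n - i) (Suc k - i) =
      ?c i * (int (Suc k - i) * ?S (n - i) (Suc k - i)) + ?c i * ?S (n - i) (k - i)" if "i \<le> k" for i
  proof (cases "i \<le> n")
    case True
    then show ?thesis
      using that by (simp only: Suc_diff_le Stirling.simps of_nat_add of_nat_mult distrib_left)
  qed (simp add: binomial_eq_0)
  have top: "?c (Suc k) * ?S (n - k) 0 = 0"
    by (cases "n \<le> k"; cases "n - k") auto
  have "nosing_altsum (Suc n) (Suc k) = (\<Sum>i\<le>k. ?c i * (int (Suc k - i) * ?S (n - i) (Suc k - i)))"
    unfolding pascal using top by (simp add: stir sum.distrib del: Stirling.simps)
  \<comment> \<open>The added term has the factor \<open>Suc k - Suc k\<close>. Next, the factor
    \<open>Suc k - i\<close> is split into its two parts.\<close>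
  also have "\<dots> = (\<Sum>i\<le>Suc k. ?c i * (int (Suc k - i) * ?S (n - i) (Suc k - i)))"
    by simp
  also have "\<dots> = (\<Sum>i\<le>Suc k. int (Suc k) * (?c i * ?S (n - i) (Suc k - i))
                    - int i * ?c i * ?S (n - i) (Suc k - i))"
    by (intro sum.cong refl) (simp add: of_nat_diff algebra_simps)
  also have "\<dots> = int (Suc k) * nosing_altsum n (Suc k) - (\<Sum>i\<le>Suc k. int i * ?c i * ?S (n - i) (Suc k - i))"
    unfolding sum_subtractf nosing_altsum_def sum_distrib_left[symmetric] by simp
  also have "(\<Sum>i\<le>Suc k. int i * ?c i * ?S (n - i) (Suc k - i)) = - (int n * nosing_altsum (n - 1) k)"
  proof -
    \<comment> \<open>Absorption turns the factor \<open>i\<close> into \<open>n\<close> and lowers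
      both binomial arguments; shifting the index then gives the sum for \<open>n - 1\<close> and
      \<open>k\<close>.\<close>
    have abs: "int (Suc j) * int (n choose Suc j) = int n * int ((n - 1) choose j)" for j
      by (cases n) (simp_all only: of_nat_mult[symmetric] Suc_times_binomial, simp_all)
    have "int (Suc j) * ?c (Suc j) * ?S (n - Suc j) (Suc k - Suc j) =
        - (int n * ((-1) ^ j * int ((n - 1) choose j) * ?S (n - 1 - j) (k - j)))" for j
    proof -
      have "int (Suc j) * ?c (Suc j) * ?S (n - Suc j) (Suc k - Suc j) =
        - ((-1) ^ j * (int (Suc j) * int (n choose Suc j)) * ?S (n - Suc j) (k - j))" by simp
      then show ?thesis unfolding abs by simp
    qed
    then show ?thesis
      unfolding nosing_altsum_def sum_distrib_left by (simp only: sum.atMost_Suc_shift sum_negf)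
  qed
  finally show ?thesis by simp
qed

text \<open>Both sides satisfy the same recurrence. It reaches back to sets with two points fewer,
  hence strong induction on the size.\<close>

lemma card_nosing_partitions:
  assumes "finite A"
  shows "int (card (nosing_partitions A k)) = nosing_altsum (card A) k"
  using assms
proof (induction "card A" arbitrary: A k rule: less_induct)
  case less
  show ?case
  proof (cases k)
    case 0
    have "nosing_partitions A 0 = (if A = {} then {{}} else {})"
      using finite_elements[OF less.prems]
      by (auto simp: nosing_partitions_def partition_on_def)
    then show ?thesis using 0 less.prems
      by (cases "card A") (auto simp: nosing_altsum_def)
  next
    case (Suc j)
    show ?thesis
    proof (cases "A = {}")
      case True
      then show ?thesis
        using Suc by (auto simp: nosing_partitions_def partition_on_empty nosing_altsum_def sum.atMost_Suc_shift)
    next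
      case False
      then obtain x B where A: "A = insert x B" "x \<notin> B" by (metis equals0I mk_disjoint_insert)
      then have B: "finite B" "card A = Suc (card B)" using less.prems by auto
      have "int (card (nosing_partitions A k)) =
          int (Suc j) * nosing_altsum (card B) (Suc j) + (\<Sum>y\<in>B. nosing_altsum (card B - 1) j)"
        unfolding A(1) Suc card_nosing_partitions_insert[OF B(1) A(2)]
        using B less.hyps[of B] less.hyps[of "B - {_}"]
        by (simp add: card_Diff_singleton_if less_Suc_eq_le del: of_nat_Suc mult_Suc)
      then show ?thesis using B by (simp add: nosing_altsum_Suc_Suc Suc)
    qed
  qed
qed

section \<open>Homology\<close>

definition critical_simplices :: "nat \<Rightarrow> nat \<Rightarrow> nat set set set" where
  "critical_simplices n d = {\<sigma> \<in> simplices_deg (Xn n) d. uncovered n \<sigma> = {}}"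

lemma chain_support_critical:
  "f \<in> carrier (chain_group (Xn n) d) \<Longrightarrow> uncovered n \<sigma> = {} \<Longrightarrow>
   \<sigma> \<notin> critical_simplices n d \<Longrightarrow> f \<sigma> = 0"
  by (auto simp: critical_simplices_def chain_group_def)

text \<open>Each point of a block of a critical simplex lies in a big block, which by disjointness
  is the same block. So all blocks are big and together they cover.\<close>

lemma card_critical_simplices: "card (critical_simplices n (Suc q)) = beta n q"
proof -
  have "critical_simplices n (Suc q) = {P. partition_on {1..n} P \<and> card P = Suc q \<and>
          (\<forall>B\<in>P. 2 \<le> card B \<and> B \<noteq> {1..n})}" (is "_ = ?P")
  proof (intro equalityI subsetI)
    fix \<sigma> assume "\<sigma> \<in> critical_simplices n (Suc q)"
    then have s: "\<sigma> \<subseteq> proper_subsets n" "disjoint \<sigma>" "card \<sigma> = Suc q"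
      and cov: "{1..n} \<subseteq> \<Union>(big \<sigma>)"
      by (auto simp: critical_simplices_def simplices_deg_Xn uncovered_def)
    have bigB: "2 \<le> card B" if B: "B \<in> \<sigma>" for B
    proof -
      have "B \<noteq> {}" "B \<subseteq> {1..n}" using B s(1) by (auto simp: proper_subsets_def)
      then obtain i where "i \<in> B" "i \<in> {1..n}" by blast
      then obtain C where "C \<in> \<sigma>" "2 \<le> card C" "i \<in> C" using cov by (auto simp: big_def)
      with B \<open>i \<in> B\<close> disjointD[OF s(2), of B C] show ?thesis by auto
    qed
    have "\<Union>\<sigma> = {1..n}"
      using cov s(1) by (auto simp: big_def proper_subsets_def)
    then show "\<sigma> \<in> ?P" using s bigB by (auto simp: partition_on_def proper_subsets_def)
  next
    fix P assume "P \<in> ?P"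
    then have P: "partition_on {1..n} P" "card P = Suc q" "\<And>B. B \<in> P \<Longrightarrow> 2 \<le> card B \<and> B \<noteq> {1..n}"
      by auto
    then have "big P = P" by (auto simp: big_def)
    then show "P \<in> critical_simplices n (Suc q)" using P
      by (fastforce simp: critical_simplices_def simplices_deg_Xn uncovered_def proper_subsets_def partition_on_def)
  qed
  then show ?thesis by (simp add: beta_def)
qed

lemma finite_critical_simplices: "finite (critical_simplices n d)"
  by (rule finite_subset[of _ "Pow (proper_subsets n)"])
    (auto simp: critical_simplices_def simplices_deg_Xn)

text \<open>The blocks of \<sigma> already cover every point, so any further vertex meets one of
  them: \<sigma> has no cofaces.\<close>

lemma bdX_covered:
  assumes f: "f \<in> carrier (chain_group (Xn n) d)" and "uncovered n \<sigma> = {}"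
  shows "bdX n f \<sigma> = 0"
  unfolding face_map_def
proof (rule sum.neutral, rule ballI)
  fix v assume v: "v \<in> proper_subsets n - \<sigma>"
  then have "v \<noteq> {}" "v \<subseteq> {1..n}" by (auto simp: proper_subsets_def)
  then obtain i where i: "i \<in> v" "i \<in> {1..n}" by blast
  then obtain w where w: "w \<in> \<sigma>" "i \<in> w" using assms(2) by (auto simp: uncovered_def big_def)
  have "\<not> disjoint (insert v \<sigma>)"
    using v w i disjointD[of "insert v \<sigma>" v w] by auto
  then have "f (insert v \<sigma>) = 0"
    by (intro chain_outside[OF f]) (simp add: simplices_deg_Xn)
  then show "(-1) ^ vpos set_key \<sigma> v * f (insert v \<sigma>) = 0" by simp
qed

lemma bdX_bdX:
  assumes "f \<in> carrier (chain_group (Xn n) d)"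
  shows "bdX n (bdX n f) = (\<lambda>_. 0)"
proof
  fix \<tau>
  show "bdX n (bdX n f) \<tau> = 0"
  proof (cases "finite \<tau>")
    case False
    then have "f (insert v (insert w \<tau>)) = 0" for v w
      by (intro chain_outside[OF assms]) (simp add: simplices_deg_def)
    then show ?thesis by (simp add: face_map_def)
  qed (simp add: face_map_face_map inj_on_set_key)
qed

lemma bdX_chain:
  "f \<in> carrier (chain_group (Xn n) (Suc d)) \<Longrightarrow> bdX n f \<in> carrier (chain_group (Xn n) d)"
  by (rule face_map_in_chain_group[rotated]) (auto intro: Xn_closed)

lemma mem_cycles_Xn:
  "f \<in> cycles (Xn n) set_key d \<longleftrightarrow> f \<in> carrier (chain_group (Xn n) d) \<and> bdX n f = (\<lambda>_. 0)"
  by (auto simp: cycles_def bd_Xn)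

lemma mem_boundaries_Xn:
  "f \<in> boundaries (Xn n) set_key d \<longleftrightarrow> (\<exists>c \<in> carrier (chain_group (Xn n) (Suc d)). f = bdX n c)"
  by (auto simp: boundaries_def bd_Xn)

text \<open>Computes the kernel of restriction to the critical simplices, by
  \<open>bdX_covered\<close> in one direction and \<open>noncritical_acyclic\<close> in the
  other.\<close>

lemma boundaries_Xn_iff:
  assumes n: "2 \<le> n" and z: "z \<in> cycles (Xn n) set_key d"
  shows "z \<in> boundaries (Xn n) set_key d \<longleftrightarrow> (\<forall>\<sigma>\<in>critical_simplices n d. z \<sigma> = 0)"
proof
  assume "z \<in> boundaries (Xn n) set_key d"
  then show "\<forall>\<sigma>\<in>critical_simplices n d. z \<sigma> = 0"
    by (auto simp: mem_boundaries_Xn critical_simplices_def bdX_covered)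
next
  assume "\<forall>\<sigma>\<in>critical_simplices n d. z \<sigma> = 0"
  then have "z \<sigma> = 0" if "uncovered n \<sigma> = {}" for \<sigma>
    using that z chain_support_critical[of z n d \<sigma>] by (auto simp: mem_cycles_Xn)
  then obtain c where "c \<in> carrier (chain_group (Xn n) (Suc d))" "bdX n c = z"
    using noncritical_acyclic[OF n, of z d] z by (auto simp: mem_cycles_Xn)
  then show "z \<in> boundaries (Xn n) set_key d" by (auto simp: mem_boundaries_Xn)
qed

text \<open>Extend \<open>x\<close> by 0 to a chain \<open>g\<close>. Its boundary is a cycle
  vanishing on covered sets, hence also the boundary of some \<open>c\<close> that is 0 on critical
  simplices; then \<open>g - c\<close> is the required cycle.\<close>

lemma cycle_with_critical_values:
  assumes n: "2 \<le> n"
  obtains z where "z \<in> cycles (Xn n) set_key (Suc d)"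
    "\<And>\<sigma>. \<sigma> \<in> critical_simplices n (Suc d) \<Longrightarrow> z \<sigma> = x \<sigma>"
proof -
  define g where "g \<sigma> = (if \<sigma> \<in> critical_simplices n (Suc d) then x \<sigma> else 0)" for \<sigma>
  have g: "g \<in> carrier (chain_group (Xn n) (Suc d))"
    by (simp add: chain_group_def g_def critical_simplices_def)
  obtain c where c: "c \<in> carrier (chain_group (Xn n) (Suc d))"
      "\<And>\<sigma>. uncovered n \<sigma> = {} \<Longrightarrow> c \<sigma> = 0" "bdX n c = bdX n g"
    using noncritical_acyclic[OF n bdX_chain[OF g]] bdX_bdX[OF g] bdX_covered[OF g] by metis
  show ?thesis
  proof (rule that)
    show "(\<lambda>\<sigma>. g \<sigma> - c \<sigma>) \<in> cycles (Xn n) set_key (Suc d)"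
      using g c(1,3) by (auto simp: mem_cycles_Xn chain_group_def face_map_diff fun_eq_iff)
    show "g \<sigma> - c \<sigma> = x \<sigma>" if "\<sigma> \<in> critical_simplices n (Suc d)" for \<sigma>
      using that c(2) by (simp add: g_def critical_simplices_def)
  qed
qed

section \<open>The homology group as a quotient of the cycle group\<close>

lemma group_cycles_Xn: "group (chain_group (Xn n) d\<lparr>carrier := cycles (Xn n) set_key d\<rparr>)"
proof (rule groupI, goal_cases)
  case (1 f g)
  then show ?case
    by (auto simp: mem_cycles_Xn chain_group_def face_map_add fun_eq_iff)
next
  case 2
  then show ?case by (auto simp: mem_cycles_Xn chain_group_def face_map_def)
next
  case (5 f)
  then show ?case
    by (intro bexI[of _ "\<lambda>\<sigma>. 0 - f \<sigma>"])
      (auto simp: mem_cycles_Xn chain_group_def face_map_def sum_negf fun_eq_iff)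
qed (auto simp: chain_group_def add.assoc)

text \<open>First isomorphism theorem for the restriction of cycles to the critical
  simplices.\<close>

lemma reduced_homology_Xn:
  assumes n: "2 \<le> n"
  shows "group (reduced_homology (Xn n) set_key q)"
    and "reduced_homology (Xn n) set_key q \<cong> sum_group {..<beta n q} (\<lambda>_. integer_group)"
proof -
  let ?C = "critical_simplices n (Suc q)"
  let ?G = "chain_group (Xn n) (Suc q)\<lparr>carrier := cycles (Xn n) set_key (Suc q)\<rparr>"
  let ?H = "sum_group {..<beta n q} (\<lambda>_. integer_group)"
  obtain e where e: "bij_betw e {..<beta n q} ?C"
    using finite_critical_simplices[of n "Suc q"] card_critical_simplices[of n q]
    by (metis bij_betw_from_nat_into_finite)
  \<comment> \<open>Lists the values of \<open>z\<close> on the critical simplices in the numbering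
    \<open>e\<close>. It is restricted to the index set because elements of \<open>sum_group\<close>
    are extensional functions.\<close>
  define h where "h z = (\<lambda>i\<in>{..<beta n q}. z (e i) :: int)" for z
  have carrH: "carrier ?H = extensional {..<beta n q}"
    by (subst carrier_sum_group) (auto simp: PiE_def)
  interpret group_hom ?G ?H h
  proof (rule group_hom.intro)
    show "group ?G" by (rule group_cycles_Xn)
    show "group ?H" by simp
    show "group_hom_axioms ?G ?H h"
      by (intro group_hom_axioms.intro homI)
        (auto simp: carrH h_def chain_group_def)
  qed
  have img: "e ` {..<beta n q} = ?C" using e by (simp add: bij_betw_def)
  have eC: "e i \<in> ?C" if "i < beta n q" for i
    using e that by (auto simp: bij_betw_def)
  have ker: "kernel ?G ?H h = boundaries (Xn n) set_key (Suc q)"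
  proof -
    have "h z = \<one>\<^bsub>?H\<^esub> \<longleftrightarrow> (\<forall>\<sigma>\<in>?C. z \<sigma> = 0)" for z
    proof -
      have "h z = \<one>\<^bsub>?H\<^esub> \<longleftrightarrow> (\<forall>i\<in>{..<beta n q}. z (e i) = 0)"
        by (auto simp: h_def fun_eq_iff restrict_def)
      also have "\<dots> \<longleftrightarrow> (\<forall>\<sigma>\<in>e ` {..<beta n q}. z \<sigma> = 0)" by simp
      finally show ?thesis unfolding img .
    qed
    moreover have "boundaries (Xn n) set_key (Suc q) \<subseteq> cycles (Xn n) set_key (Suc q)"
      by (auto simp: mem_boundaries_Xn mem_cycles_Xn bdX_chain bdX_bdX)
    ultimately show ?thesis
      using boundaries_Xn_iff[OF n, of _ "Suc q"] by (auto simp: kernel_def)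
  qed
  show "group (reduced_homology (Xn n) set_key q)"
    using normal.factorgroup_is_group[OF normal_kernel] by (simp add: reduced_homology_def ker)
  have onto: "h ` carrier ?G = carrier ?H"
  proof
    show "h ` carrier ?G \<subseteq> carrier ?H" by (auto simp: carrH h_def)
    show "carrier ?H \<subseteq> h ` carrier ?G"
    proof
      fix x assume x: "x \<in> carrier ?H"
      \<comment> \<open>The prescribed critical values are those of \<open>x\<close>, carried over
        by the inverse of \<open>e\<close>.\<close>
      obtain z where z: "z \<in> cycles (Xn n) set_key (Suc q)"
        "\<And>\<sigma>. \<sigma> \<in> ?C \<Longrightarrow> z \<sigma> = x (inv_into {..<beta n q} e \<sigma>)"
        by (rule cycle_with_critical_values[OF n, where d = q
              and x = "\<lambda>\<sigma>. x (inv_into {..<beta n q} e \<sigma>)"]) blast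
      have "h z = x"
      proof (rule extensionalityI)
        show "h z \<in> extensional {..<beta n q}" by (simp add: h_def)
        show "x \<in> extensional {..<beta n q}" using x by (simp add: carrH)
        show "h z i = x i" if "i \<in> {..<beta n q}" for i
          using that z(2) eC bij_betw_inv_into_left[OF e] by (simp add: h_def)
      qed
      with z(1) show "x \<in> h ` carrier ?G" by auto
    qed
  qed
  show "reduced_homology (Xn n) set_key q \<cong> ?H"
    using FactGroup_iso[OF onto] by (simp add: reduced_homology_def ker)
qed

text \<open>A single block would be the whole set, and \<open>q + 1\<close> disjoint blocks of size
  at least 2 need \<open>2 * (q + 1)\<close> points.\<close>

lemma beta_eq_0:
  assumes "q = 0 \<or> n div 2 < Suc q"
  shows "beta n q = 0"
proof -
  have False if P: "partition_on {1..n} P" "card P = Suc q" "\<And>B. B \<in> P \<Longrightarrow> 2 \<le> card B \<and> B \<noteq> {1..n}" for P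
  proof (cases "q = 0")
    case True
    then obtain B where "P = {B}" using P(2) by (auto simp: card_1_singleton_iff)
    with P(1,3) show False by (auto dest: partition_onD1)
  next
    case False
    have fin: "finite B" if "B \<in> P" for B
      using P(3)[OF that] by (intro card_ge_0_finite) simp
    have "(\<Sum>B\<in>P. 2) \<le> (\<Sum>B\<in>P. card B)" using P(3) by (intro sum_mono) auto
    also have "\<dots> = card (\<Union>P)"
      using partition_onD2[OF P(1)] fin
      by (intro card_Union_disjoint[symmetric]) (simp_all add: pairwise_def disjoint_def disjnt_def)
    also have "\<Union>P = {1..n}" using partition_onD1[OF P(1)] ..
    finally have "2 * Suc q \<le> n" using P(2) by simp
    then have "Suc q \<le> n div 2" by (simp add: less_eq_div_iff_mult_less_eq)
    with False assms show False by simp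
  qed
  then have "{P. partition_on {1..n} P \<and> card P = Suc q \<and> (\<forall>B\<in>P. 2 \<le> card B \<and> B \<noteq> {1..n})} = {}"
    by blast
  then show ?thesis unfolding beta_def by (simp only: card.empty)
qed

text \<open>With at least two blocks none is the whole set, since any other block would be nonempty
  and disjoint from it. So the properness condition in \<open>beta\<close> holds
  automatically.\<close>

lemma beta_eq_nosing_altsum:
  assumes "0 < q"
  shows "int (beta n q) = nosing_altsum n (Suc q)"
proof -
  have "B \<noteq> {1..n}" if P: "partition_on {1..n} P" "card P = Suc q" "B \<in> P" for P B
  proof
    assume B: "B = {1..n}"
    have "C = B" if C: "C \<in> P" for C
    proof (rule ccontr)
      assume "C \<noteq> B"
      then have "C \<inter> B = {}" using disjointD[OF partition_onD2[OF P(1)] C P(3)] by simp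
      moreover have "C \<subseteq> B" using partition_onD1[OF P(1)] C B by auto
      ultimately have "C = {}" by blast
      then show False using partition_onD3[OF P(1)] C by simp
    qed
    with P(3) have "P = {B}" by blast
    with P(2) assms show False by simp
  qed
  then have "{P. partition_on {1..n} P \<and> card P = Suc q \<and> (\<forall>B\<in>P. 2 \<le> card B \<and> B \<noteq> {1..n})}
      = nosing_partitions {1..n} (Suc q)"
    unfolding nosing_partitions_def by blast
  then show ?thesis using card_nosing_partitions[of "{1..n}" "Suc q"] by (simp add: beta_def)
qed

theorem theorem1:
  fixes n q :: nat
  assumes "2 \<le> n" and "q \<le> n - 1"
  shows "reduced_homology (Xn n) set_key q \<cong> sum_group {..<beta n q} (\<lambda>_. integer_group)
     \<and> ((q = 0 \<or> n div 2 - 1 < q) \<longrightarrow> trivial_group (reduced_homology (Xn n) set_key q))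
     \<and> (0 < q \<longrightarrow> int (beta n q) =
          (\<Sum>i = 0..q + 1. (-1) ^ i * int (n choose i) * int (Stirling (n - i) (q + 1 - i))))"
proof (intro conjI impI)
  show iso: "reduced_homology (Xn n) set_key q \<cong> sum_group {..<beta n q} (\<lambda>_. integer_group)"
    using assms(1) by (rule reduced_homology_Xn(2))
  show "trivial_group (reduced_homology (Xn n) set_key q)" if "q = 0 \<or> n div 2 - 1 < q"
  proof -
    \<comment> \<open>Even with truncated subtraction, \<open>n div 2 - 1 < q\<close> yields
      \<open>n div 2 < Suc q\<close>.\<close>
    have 0: "beta n q = 0" using that by (intro beta_eq_0) auto
    let ?H = "sum_group {..<0::nat} (\<lambda>_. integer_group)"
    have "trivial_group ?H"
      by (auto simp: trivial_group_def carrier_sum_group)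
    moreover have "reduced_homology (Xn n) set_key q \<cong> ?H" using iso 0 by simp
    moreover have "group (reduced_homology (Xn n) set_key q)"
      using assms(1) by (rule reduced_homology_Xn(1))
    ultimately show ?thesis
      using isomorphic_group_triviality[of "reduced_homology (Xn n) set_key q" ?H] by simp
  qed
  show "int (beta n q) =
      (\<Sum>i = 0..q + 1. (-1) ^ i * int (n choose i) * int (Stirling (n - i) (q + 1 - i)))" if "0 < q"
    using beta_eq_nosing_altsum[OF that, of n] by (simp only: nosing_altsum_def atLeast0AtMost Suc_eq_plus1)
qed

end
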